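(* Let $\nu(x,y)$ be a smooth solution, on a domain of $\mathbb R^2=\mathbb L$, of the partial differential equation $$(\ln\nu)_{xx}-(\ln\nu)_{yy}+2\nu=0$$ satisfying $\nu>0$ and $\nu_x\nu_y\neq0$. Then locally (in a neighborhood of every point) $\nu$ is given by the formula $$\nu=\frac{4(u_x^2-u_y^2)}{(u^2-v^2+1)^2},\qquad u^2-v^2+1\neq0,$$ where $w=u+jv$ is a holomorphic function in $\mathbb L$.
   Context: Subscripts $x,y$ denote partial derivatives. $\mathbb L=\{x+jy:\ x,y\in\mathbb R\}$, $j^2=1$, is the Lorentz plane (split-complex numbers), identified with $\mathbb R^2$. A smooth function $w=u+jv$ on an open subset of $\mathbb L$ is holomorphic in $\mathbb L$ if $\frac12(\partial_x-j\partial_y)w=0$, i.e. $u_x=v_y$ and $u_y=v_x$. *)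

theory Defs
  imports "HOL-Analysis.Analysis"
begin

text \<open>Smoothness of class \<open>C\<^sup>k\<close> and \<open>C\<^sup>\<infinity>\<close> on an open set: iterated directional derivatives.\<close>

primrec C_k_on ::
  "nat \<Rightarrow> ('a::real_normed_vector \<Rightarrow> 'b::real_normed_vector) \<Rightarrow> 'a set \<Rightarrow> bool" where
  "C_k_on 0 f S \<longleftrightarrow> continuous_on S f"
| "C_k_on (Suc k) f S \<longleftrightarrow>
     (\<forall>z\<in>S. f differentiable (at z)) \<and> (\<forall>h. C_k_on k (\<lambda>z. frechet_derivative f (at z) h) S)"

definition smooth_on :: "('a::real_normed_vector \<Rightarrow> 'b::real_normed_vector) \<Rightarrow> 'a set \<Rightarrow> bool" where
  "smooth_on f S \<longleftrightarrow> (\<forall>k. C_k_on k f S)"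

text \<open>The partial derivatives \<open>f\<^sub>x\<close>, \<open>f\<^sub>y\<close>.
  The value at \<open>z\<close> depends only on \<open>f\<close> near \<open>z\<close>, so on an open set they do not
  see the values of \<open>f\<close> outside it.\<close>

definition pd_x :: "(real \<times> real \<Rightarrow> 'b::real_normed_vector) \<Rightarrow> real \<times> real \<Rightarrow> 'b" where
  "pd_x f z = vector_derivative (\<lambda>t. f (t, snd z)) (at (fst z))"

definition pd_y :: "(real \<times> real \<Rightarrow> 'b::real_normed_vector) \<Rightarrow> real \<times> real \<Rightarrow> 'b" where
  "pd_y f z = vector_derivative (\<lambda>t. f (fst z, t)) (at (snd z))"

text \<open>The Lorentz plane: \<open>x + j y\<close> with \<open>j\<^sup>2 = 1\<close> is the pair \<open>(x, y)\<close>. Addition, real scaling and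
  topology are those of the product type; the product is a separate operation.\<close>

type_synonym lorentz = "real \<times> real"

definition lorentz_mult :: "lorentz \<Rightarrow> lorentz \<Rightarrow> lorentz" where
  "lorentz_mult a b = (fst a * fst b + snd a * snd b, fst a * snd b + snd a * fst b)"

definition lorentz_j :: lorentz where
  "lorentz_j = (0, 1)"

lemma lorentz_j_squared: "lorentz_mult lorentz_j lorentz_j = (1, 0)"
  by (simp add: lorentz_mult_def lorentz_j_def)

definition lorentz_dbar :: "(lorentz \<Rightarrow> lorentz) \<Rightarrow> lorentz \<Rightarrow> lorentz" where
  "lorentz_dbar w z = (1/2) *\<^sub>R (pd_x w z - lorentz_mult lorentz_j (pd_y w z))"

definition lorentz_holomorphic_on :: "(lorentz \<Rightarrow> lorentz) \<Rightarrow> lorentz set \<Rightarrow> bool" where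
  "lorentz_holomorphic_on w S \<longleftrightarrow> open S \<and> smooth_on w S \<and> (\<forall>z\<in>S. lorentz_dbar w z = 0)"

lemma pd_eq_frechet_derivative:
  assumes "f differentiable (at z)"
  shows "pd_x f z = frechet_derivative f (at z) (1, 0)"
    and "pd_y f z = frechet_derivative f (at z) (0, 1)"
proof -
  let ?F = "frechet_derivative f (at z)"
  have F: "(f has_derivative ?F) (at z)"
    using assms frechet_derivative_works by blast
  then have lin: "linear ?F"
    by (rule has_derivative_linear)
  have F': "(f has_derivative ?F) (at (fst z, snd z))"
    using F by simp
  have "((\<lambda>t. (t, snd z)) has_derivative (\<lambda>h. (h, 0))) (at (fst z))"
    by (intro has_derivative_Pair has_derivative_const has_derivative_ident)
  from has_derivative_compose[OF this F']
  have "((\<lambda>t. f (t, snd z)) has_derivative (\<lambda>h. ?F (h, 0))) (at (fst z))" .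
  moreover have "(\<lambda>h. ?F (h, 0)) = (\<lambda>h. h *\<^sub>R ?F (1, 0))"
    using linear_scale[OF lin, of _ "(1, 0)"] by (intro ext) (metis mult.right_neutral mult_zero_right real_scaleR_def scaleR_Pair)
  ultimately show "pd_x f z = ?F (1, 0)"
    unfolding pd_x_def by (intro vector_derivative_at) (simp only: has_vector_derivative_def)
  have "((\<lambda>t. (fst z, t)) has_derivative (\<lambda>h. (0, h))) (at (snd z))"
    by (intro has_derivative_Pair has_derivative_const has_derivative_ident)
  from has_derivative_compose[OF this F']
  have "((\<lambda>t. f (fst z, t)) has_derivative (\<lambda>h. ?F (0, h))) (at (snd z))" .
  moreover have "(\<lambda>h. ?F (0, h)) = (\<lambda>h. h *\<^sub>R ?F (0, 1))"
    using linear_scale[OF lin, of _ "(0, 1)"] by (intro ext) (metis mult.right_neutral mult_zero_right real_scaleR_def scaleR_Pair)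
  ultimately show "pd_y f z = ?F (0, 1)"
    unfolding pd_y_def by (intro vector_derivative_at) (simp only: has_vector_derivative_def)
qed

lemma lorentz_dbar_eq_0_iff:
  fixes u v :: "lorentz \<Rightarrow> real"
  assumes "u differentiable (at z)" "v differentiable (at z)"
  shows "lorentz_dbar (\<lambda>z. (u z, v z)) z = 0 \<longleftrightarrow> pd_x u z = pd_y v z \<and> pd_y u z = pd_x v z"
proof -
  have D: "((\<lambda>z. (u z, v z)) has_derivative
      (\<lambda>h. (frechet_derivative u (at z) h, frechet_derivative v (at z) h))) (at z)"
    using assms by (intro has_derivative_Pair) (simp_all add: frechet_derivative_works)
  then have "(\<lambda>z. (u z, v z)) differentiable (at z)"
    by (auto simp: differentiable_def)
  from pd_eq_frechet_derivative[OF this] frechet_derivative_at[OF D, symmetric]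
  have "pd_x (\<lambda>z. (u z, v z)) z = (pd_x u z, pd_x v z)"
    "pd_y (\<lambda>z. (u z, v z)) z = (pd_y u z, pd_y v z)"
    using assms by (simp_all add: pd_eq_frechet_derivative)
  then show ?thesis
    by (auto simp: lorentz_dbar_def lorentz_mult_def lorentz_j_def zero_prod_def)
qed

end

theory Submission
  imports Defs
begin

text \<open>
  In the null coordinates \<open>s = x + y\<close>, \<open>t = x - y\<close> the equation for \<open>\<phi> = ln \<nu>\<close> is Liouville's
  equation \<open>\<phi>\<^sub>s\<^sub>t = - exp \<phi> / 2\<close>, and \<open>u + v = f s\<close>, \<open>u - v = g t\<close> turns the asserted formula into
  Liouville's \<open>\<nu> = 4 f' g' / (1 + f g)\<^sup>2\<close>. Choosing \<open>f' = \<nu>(\<cdot>, t\<^sub>0)\<close>,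
  \<open>g' = \<nu>(s\<^sub>0, \<cdot>) / (4 \<nu>(s\<^sub>0, t\<^sub>0))\<close> and \<open>f s\<^sub>0 = g t\<^sub>0 = 0\<close> gives the right-hand side the same
  values as \<open>\<nu>\<close> on the two null lines through the point. Its logarithm solves the same equation, so
  the two agree on a small null square by uniqueness for the characteristic (Goursat) problem.
\<close>

subsection \<open>Functions of class \<open>C\<^sup>k\<close>\<close>

text \<open>On an open set a derivative sees only values taken inside the set, and this passes
  through every order by induction. It is needed because a formula for
  \<open>frechet_derivative\<close> is typically known only at points of \<open>S\<close>.\<close>

lemma C_k_on_cong:
  assumes "open S" "\<And>z. z \<in> S \<Longrightarrow> f z = g z" "C_k_on k f S"
  shows "C_k_on k g S"
  using assms(2,3)
proof (induction k arbitrary: f g)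
  case 0
  then show ?case using continuous_on_cong[of S S f g] by simp
next
  case (Suc k)
  have D: "(g has_derivative frechet_derivative f (at z)) (at z)" if "z \<in> S" for z
  proof (rule has_derivative_transform_within_open[OF _ \<open>open S\<close> that])
    show "(f has_derivative frechet_derivative f (at z)) (at z)"
      using Suc.prems(2) that by (simp add: frechet_derivative_works)
  qed (use Suc.prems in auto)
  have "C_k_on k (\<lambda>z. frechet_derivative g (at z) h) S" for h
  proof (rule Suc.IH)
    show "C_k_on k (\<lambda>z. frechet_derivative f (at z) h) S" using Suc.prems by simp
  qed (metis D frechet_derivative_at)
  moreover have "\<forall>z\<in>S. g differentiable (at z)"
    using D differentiable_def by blast
  ultimately show ?case by simp
qed

lemma C_k_on_SucI:
  assumes "open S" "\<And>z. z \<in> S \<Longrightarrow> (f has_derivative f' z) (at z)"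
    and "\<And>h. C_k_on k (\<lambda>z. f' z h) S"
  shows "C_k_on (Suc k) f S"
proof -
  have "C_k_on k (\<lambda>z. frechet_derivative f (at z) h) S" for h
    by (rule C_k_on_cong[OF assms(1) _ assms(3)[of h]]) (metis assms(2) frechet_derivative_at)
  then show ?thesis using assms(2) differentiable_def by fastforce
qed

lemma C_k_on_SucD:
  assumes "C_k_on (Suc k) f S"
  shows "z \<in> S \<Longrightarrow> (f has_derivative frechet_derivative f (at z)) (at z)"
    and "C_k_on k (\<lambda>z. frechet_derivative f (at z) h) S"
  using assms by (simp_all add: frechet_derivative_works)

lemma C_k_on_bounded_linear:
  assumes "open S" "bounded_linear L" "C_k_on k f S"
  shows "C_k_on k (\<lambda>z. L (f z)) S"
  using assms(3)
proof (induction k arbitrary: f)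
  case 0
  then show ?case using bounded_linear.continuous_on[OF assms(2)] by simp
next
  case (Suc k)
  show ?case
    by (rule C_k_on_SucI[OF assms(1) bounded_linear.has_derivative[OF assms(2) C_k_on_SucD(1)[OF Suc.prems]]])
      (auto intro!: Suc.IH C_k_on_SucD(2)[OF Suc.prems])
qed

lemma C_k_on_add:
  assumes "open S" "C_k_on k f S" "C_k_on k g S"
  shows "C_k_on k (\<lambda>z. f z + g z) S"
  using assms(2,3)
proof (induction k arbitrary: f g)
  case 0
  then show ?case by (simp add: continuous_on_add)
next
  case (Suc k)
  show ?case
    by (rule C_k_on_SucI[OF assms(1) has_derivative_add[OF C_k_on_SucD(1)[OF Suc.prems(1)] C_k_on_SucD(1)[OF Suc.prems(2)]]])
      (auto intro!: Suc.IH C_k_on_SucD(2)[OF Suc.prems(1)] C_k_on_SucD(2)[OF Suc.prems(2)])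
qed

text \<open>An affine inner map has the constant derivative \<open>A\<close>, so the derivative of
  the composite in direction \<open>h\<close> is again such a composite, of the derivative of
  \<open>f\<close> in direction \<open>A h\<close>. The induction therefore needs no product
  rule.\<close>

lemma C_k_on_affine_compose:
  assumes "open U" "bounded_linear A" "\<And>z. z \<in> U \<Longrightarrow> A z + c \<in> S" "C_k_on k f S"
  shows "C_k_on k (\<lambda>z. f (A z + c)) U"
  using assms(4)
proof (induction k arbitrary: f)
  case 0
  have "continuous_on U (\<lambda>z. A z + c)"
    by (intro continuous_intros bounded_linear.continuous_on[OF assms(2)])
  then show ?case
    using continuous_on_compose2[of S f U] assms(3) 0 by auto
next
  case (Suc k)
  show ?case
  proof (rule C_k_on_SucI[OF assms(1)])
    fix z assume "z \<in> U"
    have "((\<lambda>z. A z + c) has_derivative A) (at z)"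
      using has_derivative_add[OF bounded_linear_imp_has_derivative[OF assms(2)] has_derivative_const]
      by simp
    from has_derivative_compose[OF this C_k_on_SucD(1)[OF Suc.prems assms(3)[OF \<open>z \<in> U\<close>]]]
    show "((\<lambda>z. f (A z + c)) has_derivative (\<lambda>h. frechet_derivative f (at (A z + c)) (A h))) (at z)" .
  next
    fix h show "C_k_on k (\<lambda>z. frechet_derivative f (at (A z + c)) (A h)) U"
      by (rule Suc.IH[OF C_k_on_SucD(2)[OF Suc.prems]])
  qed
qed

text \<open>The derivative of \<open>F\<close> in direction \<open>h\<close> is
  \<open>n s * h\<close>, a linear image of \<open>n\<close>, so each order of \<open>F\<close>
  comes from the preceding order of \<open>n\<close>.\<close>

lemma smooth_on_antiderivative:
  fixes F n :: "real \<Rightarrow> real"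
  assumes "open I" "\<And>s. s \<in> I \<Longrightarrow> (F has_real_derivative n s) (at s)" "smooth_on n I"
  shows "smooth_on F I"
  unfolding smooth_on_def
proof
  fix k show "C_k_on k F I"
  proof (cases k)
    case 0
    then show ?thesis
      using assms(2) by (auto intro!: continuous_at_imp_continuous_on DERIV_isCont)
  next
    case (Suc m)
    show ?thesis unfolding Suc
    proof (rule C_k_on_SucI[OF assms(1)])
      show "(F has_derivative (\<lambda>h. n s * h)) (at s)" if "s \<in> I" for s
        using assms(2)[OF that] by (simp add: has_field_derivative_def)
      show "C_k_on m (\<lambda>s. n s * h) I" for h
        using assms(3) C_k_on_bounded_linear[OF assms(1) bounded_linear_mult_left]
        by (auto simp: smooth_on_def)
    qed
  qed
qed

section \<open>Symmetry of second derivatives\<close>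

text \<open>The mean value theorem is used twice: in \<open>a\<close> for the difference of
  \<open>G\<close> between the two levels of \<open>b\<close>, then in \<open>b\<close> for
  \<open>Ga a\<close>.\<close>

lemma second_difference:
  fixes G :: "real \<Rightarrow> real \<Rightarrow> real"
  assumes "0 < e"
    and "\<And>a b. a \<in> {0..e} \<Longrightarrow> b \<in> {0..e} \<Longrightarrow> ((\<lambda>a. G a b) has_real_derivative Ga a b) (at a)"
    and "\<And>a b. a \<in> {0..e} \<Longrightarrow> b \<in> {0..e} \<Longrightarrow> (Ga a has_real_derivative Gab a b) (at b)"
  shows "\<exists>a\<in>{0<..<e}. \<exists>b\<in>{0<..<e}. G e e - G e 0 - G 0 e + G 0 0 = e\<^sup>2 * Gab a b"
proof -
  have "\<exists>a>0. a < e \<and> (G e e - G e 0) - (G 0 e - G 0 0) = (e - 0) * (Ga a e - Ga a 0)"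
    by (rule MVT2[OF assms(1)]) (auto intro!: derivative_eq_intros assms(2) simp: less_imp_le[OF assms(1)])
  then obtain a where a: "0 < a" "a < e" "(G e e - G e 0) - (G 0 e - G 0 0) = e * (Ga a e - Ga a 0)"
    by auto
  have "\<exists>b>0. b < e \<and> Ga a e - Ga a 0 = (e - 0) * Gab a b"
    by (rule MVT2[OF assms(1)]) (use a in \<open>auto intro!: assms(3)\<close>)
  then show ?thesis using a by (force simp: power2_eq_square)
qed

text \<open>The second difference over a small square is symmetric in the two variables, so it
  equals \<open>e\<^sup>2\<close> times a value of \<open>Gab\<close> and also
  \<open>e\<^sup>2\<close> times a value of \<open>Gba\<close>. Continuity at the origin rules out a
  gap between the two limits.\<close>

lemma mixed_partials_eq:
  fixes G :: "real \<Rightarrow> real \<Rightarrow> real"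
  assumes "0 < r"
    and "\<And>a b. \<bar>a\<bar> < r \<Longrightarrow> \<bar>b\<bar> < r \<Longrightarrow> ((\<lambda>a. G a b) has_real_derivative Ga a b) (at a)"
    and "\<And>a b. \<bar>a\<bar> < r \<Longrightarrow> \<bar>b\<bar> < r \<Longrightarrow> (Ga a has_real_derivative Gab a b) (at b)"
    and "\<And>a b. \<bar>a\<bar> < r \<Longrightarrow> \<bar>b\<bar> < r \<Longrightarrow> (G a has_real_derivative Gb a b) (at b)"
    and "\<And>a b. \<bar>a\<bar> < r \<Longrightarrow> \<bar>b\<bar> < r \<Longrightarrow> ((\<lambda>a. Gb a b) has_real_derivative Gba a b) (at a)"
    and "isCont (\<lambda>(a, b). Gab a b) (0, 0)" "isCont (\<lambda>(a, b). Gba a b) (0, 0)"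
  shows "Gab 0 0 = Gba 0 0"
proof (rule ccontr)
  assume "Gab 0 0 \<noteq> Gba 0 0"
  define \<epsilon> where "\<epsilon> = \<bar>Gab 0 0 - Gba 0 0\<bar> / 2"
  have "\<epsilon> > 0" using \<open>Gab 0 0 \<noteq> Gba 0 0\<close> by (simp add: \<epsilon>_def)
  obtain d1 where d1: "d1 > 0" "\<And>q. dist q (0,0) < d1 \<Longrightarrow> dist (case q of (a, b) \<Rightarrow> Gab a b) (Gab 0 0) < \<epsilon>"
    using assms(6) \<open>\<epsilon> > 0\<close> unfolding continuous_at_eps_delta by (metis case_prod_conv)
  obtain d2 where d2: "d2 > 0" "\<And>q. dist q (0,0) < d2 \<Longrightarrow> dist (case q of (a, b) \<Rightarrow> Gba a b) (Gba 0 0) < \<epsilon>"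
    using assms(7) \<open>\<epsilon> > 0\<close> unfolding continuous_at_eps_delta by (metis case_prod_conv)
  \<comment> \<open>The bound \<open>e < r\<close> keeps the closed square in the domain. Its inner
    points are at distance at most \<open>a + b < 2 * e\<close> from the origin, hence within
    \<open>d1\<close> and \<open>d2\<close>.\<close>
  define e where "e = min (r/2) (min d1 d2 / 2)"
  have e: "0 < e" "e < r" "2 * e \<le> d1" "2 * e \<le> d2"
    using assms(1) d1(1) d2(1) by (auto simp: e_def)
  have near: "dist (a, b) (0, 0) < 2 * e" if "a \<in> {0<..<e}" "b \<in> {0<..<e}" for a b :: real
    using that sqrt_sum_squares_le_sum[of a b] by (simp add: dist_Pair_Pair)
  obtain a b where ab: "a \<in> {0<..<e}" "b \<in> {0<..<e}"
    "G e e - G e 0 - G 0 e + G 0 0 = e\<^sup>2 * Gab a b"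
    using second_difference[OF e(1), of G Ga Gab] assms(2,3) e(2) by force
  obtain b' a' where ab': "a' \<in> {0<..<e}" "b' \<in> {0<..<e}"
    "G e e - G 0 e - G e 0 + G 0 0 = e\<^sup>2 * Gba a' b'"
    using second_difference[OF e(1), of "\<lambda>b a. G a b" "\<lambda>b a. Gb a b" "\<lambda>b a. Gba a b"] assms(4,5) e(2)
    by force
  have "e\<^sup>2 * Gab a b = e\<^sup>2 * Gba a' b'" using ab ab' by linarith
  then have "Gab a b = Gba a' b'" using e by simp
  moreover have "\<bar>Gab a b - Gab 0 0\<bar> < \<epsilon>"
    using d1(2)[of "(a, b)"] near[OF ab(1,2)] e by (simp add: dist_real_def)
  moreover have "\<bar>Gba a' b' - Gba 0 0\<bar> < \<epsilon>"
    using d2(2)[of "(a', b')"] near[OF ab'(1,2)] e by (simp add: dist_real_def)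
  ultimately show False unfolding \<epsilon>_def by (smt (verit) field_sum_of_halves)
qed

lemma has_derivative_along_line:
  assumes "(f has_derivative f') (at (z + a *\<^sub>R h))"
  shows "((\<lambda>a. f (z + a *\<^sub>R h)) has_vector_derivative f' h) (at a)"
proof -
  have "((\<lambda>a. z + a *\<^sub>R h) has_derivative (\<lambda>x. x *\<^sub>R h)) (at a)"
    by (auto intro!: derivative_eq_intros)
  from has_derivative_compose[OF this assms] show ?thesis
    unfolding has_vector_derivative_def
    by (simp add: linear_scale[OF has_derivative_linear[OF assms]])
qed

text \<open>Restricting \<open>f\<close> to the points
  \<open>z + a *\<^sub>R h + b *\<^sub>R k\<close> reduces the claim to mixed partials in the two
  real parameters \<open>a\<close> and \<open>b\<close>.\<close>

lemma second_frechet_derivative_symmetric: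
  fixes f :: "'a::real_normed_vector \<Rightarrow> real"
  assumes "open S" "z \<in> S" and C: "C_k_on (Suc (Suc 0)) f S"
  shows "frechet_derivative (\<lambda>z. frechet_derivative f (at z) h) (at z) k
       = frechet_derivative (\<lambda>z. frechet_derivative f (at z) k) (at z) h"
proof -
  let ?D = "\<lambda>h z. frechet_derivative f (at z) h"
  let ?D2 = "\<lambda>h k z. frechet_derivative (?D h) (at z) k"
  define P where "P a b = z + a *\<^sub>R h + b *\<^sub>R k" for a b
  obtain \<rho> where \<rho>: "\<rho> > 0" "ball z \<rho> \<subseteq> S"
    using assms by (meson open_contains_ball)
  \<comment> \<open>The summand 1 keeps the denominator positive when \<open>h\<close> and
    \<open>k\<close> vanish and makes the estimate for \<open>P a b\<close> strict.\<close>
  define r where "r = \<rho> / (norm h + norm k + 1)"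
  have pos: "norm h + norm k + 1 > 0" by (smt (verit) norm_ge_zero)
  have r: "r > 0" using \<rho> pos by (simp add: r_def)
  have PS: "P a b \<in> S" if "\<bar>a\<bar> < r" "\<bar>b\<bar> < r" for a b
  proof -
    have "norm (a *\<^sub>R h + b *\<^sub>R k) \<le> \<bar>a\<bar> * norm h + \<bar>b\<bar> * norm k"
      by (metis norm_scaleR norm_triangle_ineq)
    also have "\<dots> \<le> r * norm h + r * norm k"
      using that by (intro add_mono mult_right_mono) auto
    also have "\<dots> < r * (norm h + norm k + 1)" using r by (simp add: algebra_simps)
    also have "\<dots> = \<rho>" using pos by (simp add: r_def)
    finally have "P a b \<in> ball z \<rho>"
      by (simp add: P_def dist_norm norm_minus_commute algebra_simps)
    then show ?thesis using \<rho> by blast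
  qed
  have D1: "(f has_derivative frechet_derivative f (at q)) (at q)" if "q \<in> S" for q
    using C_k_on_SucD(1)[OF C that] .
  have D2: "(?D l has_derivative frechet_derivative (?D l) (at q)) (at q)" if "q \<in> S" for q l
    using C_k_on_SucD(1)[OF C_k_on_SucD(2)[OF C] that] .
  have cont: "isCont (\<lambda>(a, b). ?D2 l m (P a b)) (0, 0)" for l m
  proof -
    have "continuous_on S (?D2 l m)"
      using C_k_on_SucD(2)[OF C_k_on_SucD(2)[OF C]] by simp
    then have "isCont (?D2 l m) (P (fst (0, 0)) (snd (0, 0)))"
      using assms by (simp add: P_def continuous_on_eq_continuous_at)
    moreover have "isCont (\<lambda>q::real\<times>real. P (fst q) (snd q)) (0, 0)"
      unfolding P_def by (intro continuous_intros)
    ultimately show ?thesis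
      using isCont_o2[of "(0,0)" "\<lambda>q::real\<times>real. P (fst q) (snd q)" "?D2 l m"]
      by (simp add: case_prod_unfold)
  qed
  have along_h: "((\<lambda>a. F (P a b)) has_real_derivative frechet_derivative F (at (P a b)) h) (at a)"
    if "(F has_derivative frechet_derivative F (at (P a b))) (at (P a b))" for F :: "'a \<Rightarrow> real" and a b
    using has_derivative_along_line[of F _ "z + b *\<^sub>R k" a h] that
    by (simp add: P_def has_real_derivative_iff_has_vector_derivative algebra_simps)
  have along_k: "((\<lambda>b. F (P a b)) has_real_derivative frechet_derivative F (at (P a b)) k) (at b)"
    if "(F has_derivative frechet_derivative F (at (P a b))) (at (P a b))" for F :: "'a \<Rightarrow> real" and a b
    using has_derivative_along_line[of F _ "z + a *\<^sub>R h" b k] that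
    by (simp add: P_def has_real_derivative_iff_has_vector_derivative algebra_simps)
  have "?D2 h k (P 0 0) = ?D2 k h (P 0 0)"
    by (rule mixed_partials_eq[OF r, of "\<lambda>a b. f (P a b)" "\<lambda>a b. ?D h (P a b)" _ "\<lambda>a b. ?D k (P a b)"])
      (auto intro!: along_h along_k D1 D2 PS cont)
  then show ?thesis by (simp add: P_def)
qed

subsection \<open>The Goursat problem for Liouville's equation\<close>

text \<open>If \<open>B\<close> bounds \<delta>, integrating from the line \<open>t0\<close> bounds
  \<open>\<delta>s\<close> by \<open>L * B * \<epsilon>\<close>, and integrating from the line
  \<open>s0\<close> bounds \<delta> by \<open>L * \<epsilon>\<^sup>2 * B\<close>, at most half of
  \<open>B\<close>. So the supremum is at most half of itself. The datum on \<open>t = t0\<close> is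
  put on \<open>\<delta>s\<close>, which is what the first integration starts from.\<close>

lemma goursat_zero:
  fixes \<delta> \<delta>s \<delta>st :: "real \<Rightarrow> real \<Rightarrow> real" and s0 t0 \<epsilon> L K :: real
  defines "I \<equiv> {s0-\<epsilon><..<s0+\<epsilon>}" and "J \<equiv> {t0-\<epsilon><..<t0+\<epsilon>}"
  assumes \<epsilon>: "0 < \<epsilon>" "L * \<epsilon>\<^sup>2 \<le> 1/2" "0 \<le> L"
    and ds: "\<And>s t. s \<in> I \<Longrightarrow> t \<in> J \<Longrightarrow> ((\<lambda>s. \<delta> s t) has_real_derivative \<delta>s s t) (at s)"
    and dst: "\<And>s t. s \<in> I \<Longrightarrow> t \<in> J \<Longrightarrow> (\<delta>s s has_real_derivative \<delta>st s t) (at t)"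
    and bound: "\<And>s t. s \<in> I \<Longrightarrow> t \<in> J \<Longrightarrow> \<bar>\<delta>st s t\<bar> \<le> L * \<bar>\<delta> s t\<bar>"
    and bdd: "\<And>s t. s \<in> I \<Longrightarrow> t \<in> J \<Longrightarrow> \<bar>\<delta> s t\<bar> \<le> K"
    and init: "\<And>t. t \<in> J \<Longrightarrow> \<delta> s0 t = 0" "\<And>s. s \<in> I \<Longrightarrow> \<delta>s s t0 = 0"
    and st: "s \<in> I" "t \<in> J"
  shows "\<delta> s t = 0"
proof -
  have s0: "s0 \<in> I" and t0: "t0 \<in> J" using \<epsilon> by (auto simp: I_def J_def)
  have half: "\<bar>\<delta> s t\<bar> \<le> B / 2"
    if B: "\<And>s t. s \<in> I \<Longrightarrow> t \<in> J \<Longrightarrow> \<bar>\<delta> s t\<bar> \<le> B" and st: "s \<in> I" "t \<in> J" for B s t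
  proof -
    have "B \<ge> 0" using B[OF s0 t0] by linarith
    have "\<bar>\<delta>s s t\<bar> \<le> L * B * \<epsilon>" if st: "s \<in> I" "t \<in> J" for s t
    proof -
      have "norm (\<delta>s s t - \<delta>s s t0) \<le> (L * B) * norm (t - t0)"
      proof (rule field_differentiable_bound[of J])
        fix t' assume t': "t' \<in> J"
        show "(\<delta>s s has_field_derivative \<delta>st s t') (at t' within J)"
          using dst st t' DERIV_subset by blast
        show "norm (\<delta>st s t') \<le> L * B"
          using bound[OF st(1) t'] mult_left_mono[OF B[OF st(1) t'] \<epsilon>(3)] by simp
      qed (use st t0 in \<open>auto simp: J_def\<close>)
      also have "\<dots> \<le> (L * B) * \<epsilon>"
        using st \<open>B \<ge> 0\<close> \<epsilon> by (intro mult_left_mono) (auto simp: J_def)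
      finally show ?thesis using init(2)[OF st(1)] by simp
    qed note * = this
    have "norm (\<delta> s t - \<delta> s0 t) \<le> (L * B * \<epsilon>) * norm (s - s0)"
    proof (rule field_differentiable_bound[of I])
      fix s' assume s': "s' \<in> I"
      show "((\<lambda>s. \<delta> s t) has_field_derivative \<delta>s s' t) (at s' within I)"
        using ds[OF s' st(2)] DERIV_subset by blast
      show "norm (\<delta>s s' t) \<le> L * B * \<epsilon>" using *[OF s' st(2)] by simp
    qed (use st s0 in \<open>auto simp: I_def\<close>)
    also have "\<dots> \<le> (L * B * \<epsilon>) * \<epsilon>"
      using st \<open>B \<ge> 0\<close> \<epsilon> by (intro mult_left_mono) (auto simp: I_def)
    also have "\<dots> = (L * \<epsilon>\<^sup>2) * B" by (simp add: power2_eq_square)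
    also have "\<dots> \<le> 1/2 * B" using \<epsilon> \<open>B \<ge> 0\<close> by (intro mult_right_mono) auto
    finally show ?thesis using init(1)[OF st(2)] by simp
  qed
  \<comment> \<open>The crude bound \<open>K\<close> makes this supremum finite; only then does
    \<open>?M \<le> ?M / 2\<close> force the vanishing.\<close>
  let ?M = "SUP q\<in>I\<times>J. \<bar>\<delta> (fst q) (snd q)\<bar>"
  have "bdd_above ((\<lambda>q. \<bar>\<delta> (fst q) (snd q)\<bar>) ` (I \<times> J))"
    using bdd by (auto intro!: bdd_aboveI[of _ K])
  then have le: "\<bar>\<delta> s t\<bar> \<le> ?M" if "s \<in> I" "t \<in> J" for s t
    using that by (intro cSUP_upper2[of _ _ "(s, t)"]) auto
  have "?M \<le> ?M / 2"
    using half[OF le] s0 t0 by (intro cSUP_least) auto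
  then show ?thesis using le[OF st] by linarith
qed

text \<open>On \<open>{..c}\<close> the derivative of \<open>exp\<close> is at most
  \<open>exp c\<close>. This turns the nonlinearity of Liouville's equation into the linear bound
  required by \<open>goursat_zero\<close>.\<close>

lemma exp_diff_le:
  fixes a b c :: real
  assumes "a \<le> c" "b \<le> c"
  shows "\<bar>exp a - exp b\<bar> \<le> exp c * \<bar>a - b\<bar>"
proof -
  have "norm (exp a - exp b) \<le> exp c * norm (a - b)"
    by (rule field_differentiable_bound[of "{..c}"])
      (use assms in \<open>auto intro!: derivative_eq_intros\<close>)
  then show ?thesis by simp
qed

lemma antiderivative_at:
  fixes h :: "real \<Rightarrow> real"
  assumes "0 < r" "continuous_on {c-r..c+r} h"
  obtains f where "f c = 0" "\<And>x. \<bar>x - c\<bar> < r \<Longrightarrow> (f has_real_derivative h x) (at x)"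
proof -
  obtain g where g: "\<And>x. x \<in> {c-r..c+r} \<Longrightarrow> (g has_vector_derivative h x) (at x within {c-r..c+r})"
    using antiderivative_continuous[OF assms(2)] by blast
  show ?thesis
  proof (rule that[of "\<lambda>x. g x - g c"])
    fix x assume "\<bar>x - c\<bar> < r"
    then have "x \<in> interior {c-r..c+r}" by auto
    then have "at x within {c-r..c+r} = at x" "x \<in> {c-r..c+r}"
      using interior_subset by (auto intro: at_within_interior)
    with g[of x] have "(g has_real_derivative h x) (at x)"
      by (simp add: has_real_derivative_iff_has_vector_derivative)
    from DERIV_diff[OF this DERIV_const] show "((\<lambda>x. g x - g c) has_real_derivative h x) (at x)"
      by simp
  qed simp
qed

text \<open>The factor \<open>4 * exp (\<phi> s0 t0)\<close> normalises the data: where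
  \<open>g\<close> vanishes the right-hand side is \<open>exp (\<phi> s t0)\<close>, and where
  \<open>f\<close> vanishes it is \<open>exp (\<phi> s0 t)\<close>. The closed square in
  \<open>cont\<close> supplies a uniform bound on \<phi>, from which the size \<epsilon> is
  chosen.\<close>

lemma liouville_goursat_solution:
  fixes \<phi> \<phi>s :: "real \<Rightarrow> real \<Rightarrow> real" and s0 t0 r :: real
  assumes r: "0 < r"
    and cont: "continuous_on ({s0-r..s0+r} \<times> {t0-r..t0+r}) (\<lambda>(s, t). \<phi> s t)"
    and ds: "\<And>s t. \<bar>s - s0\<bar> < r \<Longrightarrow> \<bar>t - t0\<bar> < r \<Longrightarrow> ((\<lambda>s. \<phi> s t) has_real_derivative \<phi>s s t) (at s)"
    and dst: "\<And>s t. \<bar>s - s0\<bar> < r \<Longrightarrow> \<bar>t - t0\<bar> < r \<Longrightarrow> (\<phi>s s has_real_derivative - exp (\<phi> s t) / 2) (at t)"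
  obtains \<epsilon> f g where "0 < \<epsilon>" "\<epsilon> \<le> r"
    and "\<And>s. \<bar>s - s0\<bar> < \<epsilon> \<Longrightarrow> (f has_real_derivative exp (\<phi> s t0)) (at s)"
    and "\<And>t. \<bar>t - t0\<bar> < \<epsilon> \<Longrightarrow> (g has_real_derivative exp (\<phi> s0 t) / (4 * exp (\<phi> s0 t0))) (at t)"
    and "\<And>s t. \<bar>s - s0\<bar> < \<epsilon> \<Longrightarrow> \<bar>t - t0\<bar> < \<epsilon> \<Longrightarrow> 0 < 1 + f s * g t"
    and "\<And>s t. \<bar>s - s0\<bar> < \<epsilon> \<Longrightarrow> \<bar>t - t0\<bar> < \<epsilon> \<Longrightarrow>
      exp (\<phi> s t) = 4 * (exp (\<phi> s t0) * (exp (\<phi> s0 t) / (4 * exp (\<phi> s0 t0)))) / (1 + f s * g t)\<^sup>2"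
proof -
  have "compact ({s0-r..s0+r} \<times> {t0-r..t0+r})" by (intro compact_Times) auto
  from compact_imp_bounded[OF compact_continuous_image[OF cont this]]
  obtain K where K: "\<And>s t. s \<in> {s0-r..s0+r} \<Longrightarrow> t \<in> {t0-r..t0+r} \<Longrightarrow> \<bar>\<phi> s t\<bar> \<le> K"
    unfolding bounded_iff by fastforce
  have "0 \<le> K" using K[of s0 t0] r by auto
  have "continuous_on {s0-r..s0+r} (\<lambda>s. (\<lambda>(s, t). \<phi> s t) (s, t0))"
    by (rule continuous_on_compose2[OF cont]) (use r in \<open>auto intro!: continuous_intros\<close>)
  then have cs: "continuous_on {s0-r..s0+r} (\<lambda>s. exp (\<phi> s t0))"
    by (intro continuous_intros) simp
  have "continuous_on {t0-r..t0+r} (\<lambda>t. (\<lambda>(s, t). \<phi> s t) (s0, t))"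
    by (rule continuous_on_compose2[OF cont]) (use r in \<open>auto intro!: continuous_intros\<close>)
  then have ct: "continuous_on {t0-r..t0+r} (\<lambda>t. exp (\<phi> s0 t) / (4 * exp (\<phi> s0 t0)))"
    by (intro continuous_intros) simp_all
  obtain f where f: "f s0 = 0" "\<And>s. \<bar>s - s0\<bar> < r \<Longrightarrow> (f has_real_derivative exp (\<phi> s t0)) (at s)"
    using antiderivative_at[OF r cs] by blast
  obtain g where g: "g t0 = 0"
    "\<And>t. \<bar>t - t0\<bar> < r \<Longrightarrow> (g has_real_derivative exp (\<phi> s0 t) / (4 * exp (\<phi> s0 t0))) (at t)"
    using antiderivative_at[OF r ct] by blast
  \<comment> \<open>\<open>3 K + 2\<close> bounds both \<open>\<phi>\<close> and the solution \<open>\<psi>\<close> below, so \<open>exp (3 K + 2)\<close> is a Lipschitz constant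
    for \<open>exp\<close> on their values.\<close>
  define \<epsilon> where "\<epsilon> = min r (exp (- (3 * K + 2)))"
  have \<epsilon>: "0 < \<epsilon>" "\<epsilon> \<le> r" "\<epsilon> \<le> exp (- (3 * K + 2))" using r by (auto simp: \<epsilon>_def)
  have "\<epsilon> \<le> 1" using \<epsilon>(3) \<open>0 \<le> K\<close> by (smt (verit) exp_le_one_iff)
  have "exp (3 * K + 2) * \<epsilon> \<le> exp (3 * K + 2) * exp (- (3 * K + 2))"
    using \<epsilon>(3) by (intro mult_left_mono) auto
  then have E1: "exp (3 * K + 2) * \<epsilon> \<le> 1" by (simp flip: exp_add)
  \<comment> \<open>This estimate serves twice: it keeps \<open>f s * g t\<close> small, and it is
    the smallness condition of \<open>goursat_zero\<close>.\<close>
  have E: "exp (3 * K + 2) * \<epsilon>\<^sup>2 \<le> 1"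
    using mult_mono[OF E1 \<open>\<epsilon> \<le> 1\<close>] \<epsilon> by (simp add: power2_eq_square mult.assoc)
  have fb: "\<bar>f s\<bar> \<le> exp K * \<epsilon>" if "\<bar>s - s0\<bar> < \<epsilon>" for s
  proof -
    have "norm (f s - f s0) \<le> exp K * norm (s - s0)"
    proof (rule field_differentiable_bound[of "{s0-\<epsilon><..<s0+\<epsilon>}"])
      fix x assume x: "x \<in> {s0-\<epsilon><..<s0+\<epsilon>}"
      show "(f has_field_derivative exp (\<phi> x t0)) (at x within {s0-\<epsilon><..<s0+\<epsilon>})"
        using x \<epsilon>(2) by (intro has_field_derivative_at_within[OF f(2)]) auto
      show "norm (exp (\<phi> x t0)) \<le> exp K" using K[of x t0] x \<epsilon>(1,2) r by auto
    qed (use that \<epsilon>(1) in auto)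
    also have "\<dots> \<le> exp K * \<epsilon>" using that by (intro mult_left_mono) auto
    finally show ?thesis using f(1) by simp
  qed
  have gb: "\<bar>g t\<bar> \<le> exp (2 * K) / 4 * \<epsilon>" if "\<bar>t - t0\<bar> < \<epsilon>" for t
  proof -
    have "norm (g t - g t0) \<le> exp (2 * K) / 4 * norm (t - t0)"
    proof (rule field_differentiable_bound[of "{t0-\<epsilon><..<t0+\<epsilon>}"])
      fix x assume x: "x \<in> {t0-\<epsilon><..<t0+\<epsilon>}"
      show "(g has_field_derivative exp (\<phi> s0 x) / (4 * exp (\<phi> s0 t0))) (at x within {t0-\<epsilon><..<t0+\<epsilon>})"
        using x \<epsilon>(2) by (intro has_field_derivative_at_within[OF g(2)]) auto
      have "\<phi> s0 x - \<phi> s0 t0 \<le> 2 * K" using K[of s0 x] K[of s0 t0] x \<epsilon>(1,2) r by auto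
      then show "norm (exp (\<phi> s0 x) / (4 * exp (\<phi> s0 t0))) \<le> exp (2 * K) / 4"
        by (simp flip: exp_diff)
    qed (use that \<epsilon>(1) in auto)
    also have "\<dots> \<le> exp (2 * K) / 4 * \<epsilon>" using that by (intro mult_left_mono) auto
    finally show ?thesis using g(1) by simp
  qed
  \<comment> \<open>The slopes of \<open>f\<close> and \<open>g\<close> are at most
    \<open>exp K\<close> and \<open>exp (2 * K) / 4\<close>, so the product is at most
    \<open>exp (3 * K) * \<epsilon>\<^sup>2 / 4\<close>.\<close>
  have fg: "\<bar>f s * g t\<bar> \<le> 1/4" if "\<bar>s - s0\<bar> < \<epsilon>" "\<bar>t - t0\<bar> < \<epsilon>" for s t
  proof -
    have "\<bar>f s * g t\<bar> \<le> (exp K * \<epsilon>) * (exp (2 * K) / 4 * \<epsilon>)"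
      unfolding abs_mult using fb[OF that(1)] gb[OF that(2)] by (intro mult_mono) auto
    also have "\<dots> = exp (3 * K) * \<epsilon>\<^sup>2 / 4"
      by (simp add: power2_eq_square algebra_simps flip: exp_add)
    also have "\<dots> \<le> exp (3 * K + 2) * \<epsilon>\<^sup>2 / 4"
      by (intro divide_right_mono mult_right_mono) auto
    finally show ?thesis using E by simp
  qed
  have pos: "0 < 1 + f s * g t" if "\<bar>s - s0\<bar> < \<epsilon>" "\<bar>t - t0\<bar> < \<epsilon>" for s t
    using fg[OF that] by linarith
  \<comment> \<open>This is the logarithm of Liouville's expression, with the logarithms of the
    slopes of \<open>f\<close> and \<open>g\<close> written out; \<open>\<psi>s\<close> is its
    derivative in \<open>s\<close>.\<close>
  define \<psi> where "\<psi> s t = \<phi> s t0 + \<phi> s0 t - \<phi> s0 t0 - 2 * ln (1 + f s * g t)" for s t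
  define \<psi>s where "\<psi>s s t = \<phi>s s t0 - 2 * (exp (\<phi> s t0) * g t) / (1 + f s * g t)" for s t
  have exp_\<psi>: "exp (\<psi> s t) = 4 * (exp (\<phi> s t0) * (exp (\<phi> s0 t) / (4 * exp (\<phi> s0 t0)))) / (1 + f s * g t)\<^sup>2"
    if "\<bar>s - s0\<bar> < \<epsilon>" "\<bar>t - t0\<bar> < \<epsilon>" for s t
  proof -
    have "exp (2 * ln (1 + f s * g t)) = (1 + f s * g t)\<^sup>2"
      using pos[OF that] by (simp add: exp_double)
    then show ?thesis by (simp add: \<psi>_def exp_diff exp_add)
  qed
  have ds_\<psi>: "((\<lambda>s. \<psi> s t) has_real_derivative \<psi>s s t) (at s)"
    if st: "\<bar>s - s0\<bar> < \<epsilon>" "\<bar>t - t0\<bar> < \<epsilon>" for s t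
    unfolding \<psi>_def \<psi>s_def using pos[OF st] st \<epsilon>(1,2) r
    by (auto intro!: derivative_eq_intros f ds simp: field_simps)
  \<comment> \<open>The term \<open>\<phi>s s t0\<close> is constant in \<open>t\<close>, and the
    quotient rule leaves -2 times the product of the slopes over
    \<open>(1 + f s * g t)\<^sup>2\<close>.\<close>
  have dst_\<psi>: "(\<psi>s s has_real_derivative - exp (\<psi> s t) / 2) (at t)"
    if st: "\<bar>s - s0\<bar> < \<epsilon>" "\<bar>t - t0\<bar> < \<epsilon>" for s t
    unfolding exp_\<psi>[OF st] unfolding \<psi>s_def using pos[OF st] st \<epsilon>(1,2) r
    by (auto intro!: derivative_eq_intros g simp: field_simps power2_eq_square)
  have \<phi>b: "\<bar>\<phi> s t\<bar> \<le> 3 * K + 2" if "\<bar>s - s0\<bar> < \<epsilon>" "\<bar>t - t0\<bar> < \<epsilon>" for s t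
  proof -
    have "\<bar>\<phi> s t\<bar> \<le> K" using that \<epsilon>(2) by (intro K) auto
    then show ?thesis using \<open>0 \<le> K\<close> by linarith
  qed
  \<comment> \<open>Three values of \<phi> contribute \<open>3 * K\<close>. The logarithm is at most
    1 in absolute value because \<open>1 + f s * g t\<close> lies between 3/4 and 5/4, and it enters
    with factor 2.\<close>
  have \<psi>b: "\<bar>\<psi> s t\<bar> \<le> 3 * K + 2" if st: "\<bar>s - s0\<bar> < \<epsilon>" "\<bar>t - t0\<bar> < \<epsilon>" for s t
  proof -
    have "ln (1 + f s * g t) \<le> 1"
      using ln_add_one_self_le_self2[of "f s * g t"] fg[OF st] by linarith
    moreover have "ln (inverse (1 + f s * g t)) \<le> inverse (1 + f s * g t) - 1"
      using pos[OF st] by (intro ln_le_minus_one) auto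
    moreover have "inverse (1 + f s * g t) \<le> inverse (1/2)"
      using fg[OF st] by (intro le_imp_inverse_le) auto
    ultimately have "\<bar>ln (1 + f s * g t)\<bar> \<le> 1" using pos[OF st] by (simp add: ln_inverse)
    moreover have "\<bar>\<phi> s t0\<bar> \<le> K" "\<bar>\<phi> s0 t\<bar> \<le> K" "\<bar>\<phi> s0 t0\<bar> \<le> K"
      using st \<epsilon>(2) r by (auto intro!: K)
    ultimately show ?thesis unfolding \<psi>_def by linarith
  qed
  \<comment> \<open>The half in \<open>L\<close> is the coefficient in Liouville's equation, so
    \<open>E\<close> gives \<open>L * \<epsilon>\<^sup>2 \<le> 1/2\<close>. The initial conditions
    hold because \<open>f s0 = 0\<close> makes \<psi> agree with \<phi> on one null line and
    \<open>g t0 = 0\<close> makes \<open>\<psi>s\<close> agree with \<open>\<phi>s\<close> on the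
    other.\<close>
  have "\<phi> s t - \<psi> s t = 0" if st: "\<bar>s - s0\<bar> < \<epsilon>" "\<bar>t - t0\<bar> < \<epsilon>" for s t
  proof (rule goursat_zero[where \<delta> = "\<lambda>s t. \<phi> s t - \<psi> s t" and ?s0.0 = s0 and ?t0.0 = t0
        and \<epsilon> = \<epsilon> and L = "exp (3 * K + 2) / 2" and K = "2 * (3 * K + 2)"
        and \<delta>s = "\<lambda>s t. \<phi>s s t - \<psi>s s t" and \<delta>st = "\<lambda>s t. - exp (\<phi> s t) / 2 - - exp (\<psi> s t) / 2"])
    fix s t assume "s \<in> {s0-\<epsilon><..<s0+\<epsilon>}" "t \<in> {t0-\<epsilon><..<t0+\<epsilon>}"
    then have st: "\<bar>s - s0\<bar> < \<epsilon>" "\<bar>t - t0\<bar> < \<epsilon>" by auto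
    then have st': "\<bar>s - s0\<bar> < r" "\<bar>t - t0\<bar> < r" using \<epsilon>(2) by auto
    show "((\<lambda>s. \<phi> s t - \<psi> s t) has_real_derivative \<phi>s s t - \<psi>s s t) (at s)"
      by (intro DERIV_diff ds ds_\<psi> st st')
    show "((\<lambda>t. \<phi>s s t - \<psi>s s t) has_real_derivative - exp (\<phi> s t) / 2 - - exp (\<psi> s t) / 2) (at t)"
      by (intro DERIV_diff dst dst_\<psi> st st')
    show "\<bar>- exp (\<phi> s t) / 2 - - exp (\<psi> s t) / 2\<bar> \<le> exp (3 * K + 2) / 2 * \<bar>\<phi> s t - \<psi> s t\<bar>"
    proof -
      have "\<bar>exp (\<phi> s t) - exp (\<psi> s t)\<bar> \<le> exp (3 * K + 2) * \<bar>\<phi> s t - \<psi> s t\<bar>"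
        using \<phi>b[OF st] \<psi>b[OF st] by (intro exp_diff_le) linarith+
      moreover have "\<bar>- exp (\<phi> s t) / 2 - - exp (\<psi> s t) / 2\<bar> = \<bar>exp (\<phi> s t) - exp (\<psi> s t)\<bar> / 2"
        by (simp add: abs_if)
      ultimately show ?thesis by simp
    qed
    show "\<bar>\<phi> s t - \<psi> s t\<bar> \<le> 2 * (3 * K + 2)"
      using order_trans[OF abs_triangle_ineq4 add_mono[OF \<phi>b[OF st] \<psi>b[OF st]]] by (simp only: mult_2)
  qed (use \<epsilon>(1) E st in \<open>auto simp: \<psi>_def \<psi>s_def f(1) g(1)\<close>)
  then have eq: "\<phi> s t = \<psi> s t" if "\<bar>s - s0\<bar> < \<epsilon>" "\<bar>t - t0\<bar> < \<epsilon>" for s t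
    using that by fastforce
  show ?thesis
  proof (rule that[of \<epsilon> f g])
    show "exp (\<phi> s t) = 4 * (exp (\<phi> s t0) * (exp (\<phi> s0 t) / (4 * exp (\<phi> s0 t0)))) / (1 + f s * g t)\<^sup>2"
      if "\<bar>s - s0\<bar> < \<epsilon>" "\<bar>t - t0\<bar> < \<epsilon>" for s t
      unfolding eq[OF that] by (rule exp_\<psi>[OF that])
  qed (fact \<epsilon>(1) \<epsilon>(2) pos
      | rule f(2), erule order_less_le_trans[OF _ \<epsilon>(2)]
      | rule g(2), erule order_less_le_trans[OF _ \<epsilon>(2)])+
qed

subsection \<open>Null coordinates in the Lorentz plane\<close>

text \<open>Moving \<open>s\<close> or \<open>t\<close> means moving along \<open>(1/2, 1/2)\<close>
  or \<open>(1/2, -1/2)\<close>. By bilinearity and symmetry the mixed second derivative in these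
  directions is a quarter of the xx-derivative minus the yy-derivative, so the equation gives it the
  value \<open>- \<nu> z / 2\<close>.\<close>

lemma liouville_null_form:
  fixes \<nu> :: "real \<times> real \<Rightarrow> real"
  assumes "open D" "C_k_on (Suc (Suc 0)) \<nu> D" "\<And>z. z \<in> D \<Longrightarrow> \<nu> z > 0"
    and pde: "\<And>z. z \<in> D \<Longrightarrow>
      pd_x (pd_x (\<lambda>p. ln (\<nu> p))) z - pd_y (pd_y (\<lambda>p. ln (\<nu> p))) z + 2 * \<nu> z = 0"
  obtains \<phi>s where
    "\<And>s t. ((s + t) / 2, (s - t) / 2) \<in> D \<Longrightarrow>
      ((\<lambda>s. ln (\<nu> ((s + t) / 2, (s - t) / 2))) has_real_derivative \<phi>s s t) (at s)"
    "\<And>s t. ((s + t) / 2, (s - t) / 2) \<in> D \<Longrightarrow>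
      (\<phi>s s has_real_derivative - \<nu> ((s + t) / 2, (s - t) / 2) / 2) (at t)"
proof -
  let ?D = "\<lambda>h z. frechet_derivative \<nu> (at z) h"
  let ?D2 = "\<lambda>h k z. frechet_derivative (?D h) (at z) k"
  let ?h = "(1/2, 1/2) :: real \<times> real" and ?k = "(1/2, -1/2) :: real \<times> real"
  \<comment> \<open>\<open>L1\<close> and \<open>L2\<close> are the first and second directional
    derivatives of \<open>ln \<nu>\<close>, expressed through those of \<nu>, so that symmetry is
    applied to \<nu> alone.\<close>
  define L1 where "L1 h z = ?D h z / \<nu> z" for h z
  define L2 where "L2 h k z = (?D2 h k z * \<nu> z - ?D h z * ?D k z) / (\<nu> z)\<^sup>2" for h k z
  have D1: "(\<nu> has_derivative frechet_derivative \<nu> (at z)) (at z)" if "z \<in> D" for z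
    using C_k_on_SucD(1)[OF assms(2) that] .
  have D2: "(?D h has_derivative frechet_derivative (?D h) (at z)) (at z)" if "z \<in> D" for z h
    using C_k_on_SucD(1)[OF C_k_on_SucD(2)[OF assms(2)] that] .
  have dL: "((\<lambda>p. ln (\<nu> p)) has_derivative (\<lambda>h. L1 h z)) (at z)" if "z \<in> D" for z
    unfolding L1_def using assms(3)[OF that]
    by (auto intro!: derivative_eq_intros D1[OF that] simp: field_simps)
  have dL1: "(L1 h has_derivative (\<lambda>k. L2 h k z)) (at z)" if "z \<in> D" for h z
  proof -
    have "((\<lambda>z. ?D h z / \<nu> z) has_derivative
        (\<lambda>k. - ?D h z * (inverse (\<nu> z) * ?D k z * inverse (\<nu> z)) + ?D2 h k z / \<nu> z)) (at z)"
      using assms(3)[OF that] by (intro has_derivative_divide D1 D2 that) auto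
    then show ?thesis
      unfolding L1_def[abs_def] L2_def using assms(3)[OF that]
      by (elim has_derivative_eq_rhs) (auto simp: field_simps power2_eq_square)
  qed
  have pd1: "pd_x (\<lambda>p. ln (\<nu> p)) z = L1 (1, 0) z" "pd_y (\<lambda>p. ln (\<nu> p)) z = L1 (0, 1) z" if "z \<in> D" for z
    using pd_eq_frechet_derivative[of "\<lambda>p. ln (\<nu> p)" z] frechet_derivative_at[OF dL[OF that], symmetric] dL[OF that]
    by (auto simp: differentiable_def)
  \<comment> \<open>The inner partial derivative is known to be \<open>L1\<close> only on
    \<open>D\<close>; openness of \<open>D\<close> lets the outer derivative be taken all the
    same.\<close>
  have pd2: "pd_x (pd_x (\<lambda>p. ln (\<nu> p))) z = L2 (1, 0) (1, 0) z"
    "pd_y (pd_y (\<lambda>p. ln (\<nu> p))) z = L2 (0, 1) (0, 1) z" if "z \<in> D" for z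
  proof -
    have x: "(pd_x (\<lambda>p. ln (\<nu> p)) has_derivative (\<lambda>k. L2 (1, 0) k z)) (at z)"
      by (rule has_derivative_transform_within_open[OF dL1[OF that] assms(1) that]) (simp add: pd1)
    have y: "(pd_y (\<lambda>p. ln (\<nu> p)) has_derivative (\<lambda>k. L2 (0, 1) k z)) (at z)"
      by (rule has_derivative_transform_within_open[OF dL1[OF that] assms(1) that]) (simp add: pd1)
    show "pd_x (pd_x (\<lambda>p. ln (\<nu> p))) z = L2 (1, 0) (1, 0) z"
      using pd_eq_frechet_derivative(1) frechet_derivative_at[OF x, symmetric] x differentiable_def by metis
    show "pd_y (pd_y (\<lambda>p. ln (\<nu> p))) z = L2 (0, 1) (0, 1) z"
      using pd_eq_frechet_derivative(2) frechet_derivative_at[OF y, symmetric] y differentiable_def by metis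
  qed
  have L2_hk: "L2 ?h ?k z = - \<nu> z / 2" if z: "z \<in> D" for z
  proof -
    have lin: "F ?h = (F (1, 0) + F (0, 1)) / 2" "F ?k = (F (1, 0) - F (0, 1)) / 2"
      if "linear F" for F :: "real \<times> real \<Rightarrow> real"
    proof -
      have "F ?h = F ((1/2) *\<^sub>R ((1, 0) + (0, 1)))" "F ?k = F ((1/2) *\<^sub>R ((1, 0) - (0, 1)))" by simp_all
      then show "F ?h = (F (1, 0) + F (0, 1)) / 2" "F ?k = (F (1, 0) - F (0, 1)) / 2"
        unfolding linear_scale[OF that] linear_add[OF that] linear_diff[OF that] by simp_all
    qed
    note lin1 = lin[OF has_derivative_linear[OF D1[OF z]]]
    note lin2 = lin[OF has_derivative_linear[OF D2[OF z]]]
    note sym = second_frechet_derivative_symmetric[OF assms(1) z assms(2)]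
    have "?D2 ?h ?k z = (?D2 (1, 0) ?h z - ?D2 (0, 1) ?h z) / 2"
      unfolding lin2(2) by (simp only: sym[of ?h])
    also have "\<dots> = (?D2 (1, 0) (1, 0) z - ?D2 (0, 1) (0, 1) z) / 4"
      unfolding lin2(1) sym[of "(1, 0)" "(0, 1)"] by (simp add: add_divide_distrib diff_divide_distrib)
    finally have D2_hk: "?D2 ?h ?k z = (?D2 (1, 0) (1, 0) z - ?D2 (0, 1) (0, 1) z) / 4" .
    \<comment> \<open>The product of the first derivatives along \<open>?h\<close> and
      \<open>?k\<close> is a quarter of a difference of squares, which matches the product terms in
      the two pure second derivatives.\<close>
    have "L2 ?h ?k z = (L2 (1, 0) (1, 0) z - L2 (0, 1) (0, 1) z) / 4"
      unfolding L2_def lin1 D2_hk by (simp add: algebra_simps add_divide_distrib diff_divide_distrib)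
    then show ?thesis using pde[OF z] pd2[OF z] by simp
  qed
  show ?thesis
  proof (rule that[of "\<lambda>s t. L1 ?h ((s + t) / 2, (s - t) / 2)"])
    fix s t :: real assume z: "((s + t) / 2, (s - t) / 2) \<in> D"
    have P: "((s + t) / 2, (s - t) / 2) = (t / 2, - t / 2) + s *\<^sub>R ?h"
      "((s + t) / 2, (s - t) / 2) = (s / 2, s / 2) + t *\<^sub>R ?k" for s t :: real
      by (simp_all add: field_simps)
    show "((\<lambda>s. ln (\<nu> ((s + t) / 2, (s - t) / 2))) has_real_derivative L1 ?h ((s + t) / 2, (s - t) / 2)) (at s)"
      using has_derivative_along_line[OF dL[OF z, unfolded P(1)]]
      by (simp only: P(1) has_real_derivative_iff_has_vector_derivative)
    show "((\<lambda>t. L1 ?h ((s + t) / 2, (s - t) / 2)) has_real_derivative - \<nu> ((s + t) / 2, (s - t) / 2) / 2) (at t)"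
      using has_derivative_along_line[OF dL1[where h = ?h, OF z, unfolded P(2)]] L2_hk[OF z]
      by (simp only: P(2) has_real_derivative_iff_has_vector_derivative)
  qed
qed

text \<open>Here \<open>f\<close> and \<open>g\<close> are the components of w = u + jv in the
  idempotent basis (1 + j)/2, (1 - j)/2, in which a holomorphic function splits into one function of
  x + y and one of x - y. The difference of squares factors because \<open>f'\<close> is the sum and
  \<open>g'\<close> the difference of the partial derivatives of \<open>u\<close>.\<close>

lemma lorentz_holomorphic_null:
  fixes f g f' g' :: "real \<Rightarrow> real"
  assumes "open I" "open J" "smooth_on f I" "smooth_on g J"
    and f': "\<And>s. s \<in> I \<Longrightarrow> (f has_real_derivative f' s) (at s)"
    and g': "\<And>t. t \<in> J \<Longrightarrow> (g has_real_derivative g' t) (at t)"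
  defines "u \<equiv> \<lambda>z. (f (fst z + snd z) + g (fst z - snd z)) / 2"
    and "v \<equiv> \<lambda>z. (f (fst z + snd z) - g (fst z - snd z)) / 2"
    and "U \<equiv> {z. fst z + snd z \<in> I \<and> fst z - snd z \<in> J}"
  shows "lorentz_holomorphic_on (\<lambda>z. (u z, v z)) U"
    and "\<And>z. z \<in> U \<Longrightarrow> (pd_x u z)\<^sup>2 - (pd_y u z)\<^sup>2 = f' (fst z + snd z) * g' (fst z - snd z)"
proof -
  have "open ((\<lambda>z. fst z + snd z) -` I \<inter> (\<lambda>z::real\<times>real. fst z - snd z) -` J)"
    by (intro open_Int open_vimage assms continuous_intros)
  moreover have "U = (\<lambda>z. fst z + snd z) -` I \<inter> (\<lambda>z. fst z - snd z) -` J"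
    by (auto simp: U_def)
  ultimately have "open U" by simp
  have bl: "bounded_linear (\<lambda>z::real\<times>real. fst z + snd z)" "bounded_linear (\<lambda>z::real\<times>real. fst z - snd z)"
    by (intro bounded_linear_add bounded_linear_sub bounded_linear_fst bounded_linear_snd)+
  have "smooth_on (\<lambda>z. (u z, v z)) U"
    unfolding smooth_on_def
  proof
    fix k
    \<comment> \<open>The zero fits the shape \<open>A z + c\<close>. The pair is then assembled
      from the two vectors of the idempotent basis, using only linear images and sums.\<close>
    have "C_k_on k (\<lambda>z. f (fst z + snd z + 0)) U"
      by (rule C_k_on_affine_compose[OF \<open>open U\<close> bl(1), where S = I])
        (use assms(3) in \<open>auto simp: smooth_on_def U_def\<close>)
    moreover have "C_k_on k (\<lambda>z. g (fst z - snd z + 0)) U"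
      by (rule C_k_on_affine_compose[OF \<open>open U\<close> bl(2), where S = J])
        (use assms(4) in \<open>auto simp: smooth_on_def U_def\<close>)
    ultimately have "C_k_on k (\<lambda>z. f (fst z + snd z + 0) *\<^sub>R (1/2::real, 1/2::real)
        + g (fst z - snd z + 0) *\<^sub>R (1/2, -1/2)) U"
      by (intro C_k_on_add C_k_on_bounded_linear[OF _ bounded_linear_scaleR_left] \<open>open U\<close>)
    moreover have "(\<lambda>z. f (fst z + snd z + 0) *\<^sub>R (1/2::real, 1/2::real)
        + g (fst z - snd z + 0) *\<^sub>R (1/2, -1/2)) = (\<lambda>z. (u z, v z))"
      by (auto simp: u_def v_def field_simps)
    ultimately show "C_k_on k (\<lambda>z. (u z, v z)) U" by simp
  qed
  have du: "(u has_derivative (\<lambda>h. (f' (fst z + snd z) * (fst h + snd h) + g' (fst z - snd z) * (fst h - snd h)) / 2)) (at z)"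
    and dv: "(v has_derivative (\<lambda>h. (f' (fst z + snd z) * (fst h + snd h) - g' (fst z - snd z) * (fst h - snd h)) / 2)) (at z)"
    if "z \<in> U" for z
  proof -
    have F: "((\<lambda>z. f (fst z + snd z)) has_derivative (\<lambda>h. f' (fst z + snd z) * (fst h + snd h))) (at z)"
      using has_derivative_compose[OF bounded_linear_imp_has_derivative[OF bl(1)], of f "(*) (f' (fst z + snd z))"] f'[of "fst z + snd z"] that
      by (simp add: U_def has_field_derivative_def)
    have G: "((\<lambda>z. g (fst z - snd z)) has_derivative (\<lambda>h. g' (fst z - snd z) * (fst h - snd h))) (at z)"
      using has_derivative_compose[OF bounded_linear_imp_has_derivative[OF bl(2)], of g "(*) (g' (fst z - snd z))"] g'[of "fst z - snd z"] that
      by (simp add: U_def has_field_derivative_def)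
    show "(u has_derivative (\<lambda>h. (f' (fst z + snd z) * (fst h + snd h) + g' (fst z - snd z) * (fst h - snd h)) / 2)) (at z)"
      unfolding u_def by (intro bounded_linear.has_derivative[OF bounded_linear_divide] has_derivative_add F G)
    show "(v has_derivative (\<lambda>h. (f' (fst z + snd z) * (fst h + snd h) - g' (fst z - snd z) * (fst h - snd h)) / 2)) (at z)"
      unfolding v_def by (intro bounded_linear.has_derivative[OF bounded_linear_divide] has_derivative_diff F G)
  qed
  have diff: "u differentiable (at z)" "v differentiable (at z)" if "z \<in> U" for z
    using du[OF that] dv[OF that] by (auto simp: differentiable_def)
  have pdu: "pd_x u z = (f' (fst z + snd z) + g' (fst z - snd z)) / 2"
    "pd_y u z = (f' (fst z + snd z) - g' (fst z - snd z)) / 2" if "z \<in> U" for z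
    by (simp_all add: pd_eq_frechet_derivative diff that flip: frechet_derivative_at[OF du[OF that]])
  have pdv: "pd_x v z = (f' (fst z + snd z) - g' (fst z - snd z)) / 2"
    "pd_y v z = (f' (fst z + snd z) + g' (fst z - snd z)) / 2" if "z \<in> U" for z
    by (simp_all add: pd_eq_frechet_derivative diff that flip: frechet_derivative_at[OF dv[OF that]])
  show "lorentz_holomorphic_on (\<lambda>z. (u z, v z)) U"
    using \<open>open U\<close> \<open>smooth_on (\<lambda>z. (u z, v z)) U\<close>
    by (simp add: lorentz_holomorphic_on_def lorentz_dbar_eq_0_iff diff pdu pdv)
  show "(pd_x u z)\<^sup>2 - (pd_y u z)\<^sup>2 = f' (fst z + snd z) * g' (fst z - snd z)" if "z \<in> U" for z
    unfolding pdu[OF that] by (simp add: power2_eq_square field_simps)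
qed

section \<open>The local representation around a point, carried back to x and y\<close>

theorem corollary5p2:
  fixes \<nu> :: "real \<times> real \<Rightarrow> real" and D :: "(real \<times> real) set"
  assumes "open D" and "connected D"
    and "smooth_on \<nu> D"
    and "\<forall>z\<in>D. \<nu> z > 0"
    and "\<forall>z\<in>D. pd_x \<nu> z * pd_y \<nu> z \<noteq> 0"
    and "\<forall>z\<in>D. pd_x (pd_x (\<lambda>p. ln (\<nu> p))) z - pd_y (pd_y (\<lambda>p. ln (\<nu> p))) z + 2 * \<nu> z = 0"
  shows "\<forall>p\<in>D. \<exists>U u v. open U \<and> p \<in> U \<and> U \<subseteq> D
    \<and> lorentz_holomorphic_on (\<lambda>z. (u z, v z)) U
    \<and> (\<forall>z\<in>U. (u z)\<^sup>2 - (v z)\<^sup>2 + 1 \<noteq> 0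
         \<and> \<nu> z = 4 * ((pd_x u z)\<^sup>2 - (pd_y u z)\<^sup>2) / ((u z)\<^sup>2 - (v z)\<^sup>2 + 1)\<^sup>2)"
proof
  fix p assume "p \<in> D"
  define s0 where "s0 = fst p + snd p"
  define t0 where "t0 = fst p - snd p"
  let ?P = "\<lambda>s t :: real. ((s + t) / 2, (s - t) / 2)"
  obtain \<rho> where \<rho>: "\<rho> > 0" "ball p \<rho> \<subseteq> D"
    using assms(1) \<open>p \<in> D\<close> by (meson open_contains_ball)
  define r where "r = \<rho> / 2"
  have r: "0 < r" "r < \<rho>" using \<rho> by (auto simp: r_def)
  \<comment> \<open>The sum of the two coordinate deviations equals the larger of the deviations in
    \<open>s\<close> and \<open>t\<close>, because |a + b| + |a - b| = 2 max(|a|, |b|). The closed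
    null square of half-width \<open>r\<close> thus lies in the ball.\<close>
  have PD: "?P s t \<in> D" if "\<bar>s - s0\<bar> \<le> r" "\<bar>t - t0\<bar> \<le> r" for s t
  proof -
    have "dist p (?P s t) \<le> \<bar>fst p - (s + t) / 2\<bar> + \<bar>snd p - (s - t) / 2\<bar>"
      using sqrt_sum_squares_le_sum_abs[of "fst p - (s + t) / 2" "snd p - (s - t) / 2"]
      by (simp add: dist_prod_def dist_real_def)
    also have "\<dots> \<le> r" 
      using that unfolding s0_def t0_def add_divide_distrib diff_divide_distrib by linarith
    finally show ?thesis using r \<rho> by auto
  qed
  have pos: "\<nu> z > 0" if "z \<in> D" for z using assms(4) that by blast
  have "continuous_on D \<nu>" "C_k_on (Suc (Suc 0)) \<nu> D"
    using assms(3) unfolding smooth_on_def by (metis C_k_on.simps(1), blast)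
  then obtain \<phi>s where \<phi>s:
    "\<And>s t. ?P s t \<in> D \<Longrightarrow> ((\<lambda>s. ln (\<nu> (?P s t))) has_real_derivative \<phi>s s t) (at s)"
    "\<And>s t. ?P s t \<in> D \<Longrightarrow> (\<phi>s s has_real_derivative - \<nu> (?P s t) / 2) (at t)"
    using liouville_null_form[OF assms(1)] pos assms(6) by blast
  have exp_ln_\<nu>: "exp (ln (\<nu> (?P s t))) = \<nu> (?P s t)" if "\<bar>s - s0\<bar> \<le> r" "\<bar>t - t0\<bar> \<le> r" for s t
    using pos[OF PD[OF that]] by simp
  have "continuous_on ({s0-r..s0+r} \<times> {t0-r..t0+r}) (\<lambda>q. \<nu> (?P (fst q) (snd q)))"
    by (rule continuous_on_compose2[OF \<open>continuous_on D \<nu>\<close>])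
      (auto intro!: continuous_intros PD)
  then have cont: "continuous_on ({s0-r..s0+r} \<times> {t0-r..t0+r}) (\<lambda>(s, t). ln (\<nu> (?P s t)))"
    unfolding case_prod_unfold
    by (rule continuous_on_ln) (use PD pos in \<open>fastforce simp: less_le\<close>)
  obtain \<epsilon> f g where \<epsilon>: "0 < \<epsilon>" "\<epsilon> \<le> r"
    and f: "\<And>s. \<bar>s - s0\<bar> < \<epsilon> \<Longrightarrow> (f has_real_derivative exp (ln (\<nu> (?P s t0)))) (at s)"
    and g: "\<And>t. \<bar>t - t0\<bar> < \<epsilon> \<Longrightarrow>
      (g has_real_derivative exp (ln (\<nu> (?P s0 t))) / (4 * exp (ln (\<nu> (?P s0 t0))))) (at t)"
    and fg: "\<And>s t. \<bar>s - s0\<bar> < \<epsilon> \<Longrightarrow> \<bar>t - t0\<bar> < \<epsilon> \<Longrightarrow> 0 < 1 + f s * g t"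
    and sol: "\<And>s t. \<bar>s - s0\<bar> < \<epsilon> \<Longrightarrow> \<bar>t - t0\<bar> < \<epsilon> \<Longrightarrow>
      exp (ln (\<nu> (?P s t))) = 4 * (exp (ln (\<nu> (?P s t0))) *
        (exp (ln (\<nu> (?P s0 t))) / (4 * exp (ln (\<nu> (?P s0 t0)))))) / (1 + f s * g t)\<^sup>2"
  proof (rule liouville_goursat_solution[OF r(1) cont])
    fix s t assume "\<bar>s - s0\<bar> < r" "\<bar>t - t0\<bar> < r"
    then have st: "\<bar>s - s0\<bar> \<le> r" "\<bar>t - t0\<bar> \<le> r" by auto
    show "((\<lambda>s. ln (\<nu> (?P s t))) has_real_derivative \<phi>s s t) (at s)"
      by (rule \<phi>s(1)[OF PD[OF st]])
    show "(\<phi>s s has_real_derivative - exp (ln (\<nu> (?P s t))) / 2) (at t)"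
      unfolding exp_ln_\<nu>[OF st] by (rule \<phi>s(2)[OF PD[OF st]])
  qed (rule that; assumption)
  \<comment> \<open>Up to a constant factor the slopes of \<open>f\<close> and \<open>g\<close> are
    restrictions of \<nu> to null lines. These lines are affine, so smoothness passes from \<nu> to
    the slopes and then to \<open>f\<close> and \<open>g\<close>.\<close>
  define f' where "f' s = \<nu> (?P s t0)" for s
  define g' where "g' t = \<nu> (?P s0 t) / (4 * \<nu> (?P s0 t0))" for t
  define I where "I = {s0-\<epsilon><..<s0+\<epsilon>}"
  define J where "J = {t0-\<epsilon><..<t0+\<epsilon>}"
  have I: "s \<in> I \<longleftrightarrow> \<bar>s - s0\<bar> < \<epsilon>" and J: "t \<in> J \<longleftrightarrow> \<bar>t - t0\<bar> < \<epsilon>" for s t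
    by (auto simp: I_def J_def)
  have df: "(f has_real_derivative f' s) (at s)" if "s \<in> I" for s
    using f[of s] that \<epsilon> exp_ln_\<nu>[of s t0] by (simp add: I f'_def)
  have dg: "(g has_real_derivative g' t) (at t)" if "t \<in> J" for t
    using g[of t] that \<epsilon> exp_ln_\<nu>[of s0 t] exp_ln_\<nu>[of s0 t0] by (simp add: J g'_def)
  have "open I" "open J" by (auto simp: I_def J_def)
  have "smooth_on f' I"
    unfolding smooth_on_def
  proof
    fix k
    have P: "?P s t0 = s *\<^sub>R (1/2, 1/2) + (t0 / 2, - t0 / 2)" for s
      by (simp add: add_divide_distrib diff_divide_distrib)
    show "C_k_on k f' I"
      unfolding f'_def[abs_def] P
    proof (rule C_k_on_affine_compose[OF \<open>open I\<close> bounded_linear_scaleR_left, where S = D])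
      show "s *\<^sub>R (1/2, 1/2) + (t0 / 2, - t0 / 2) \<in> D" if "s \<in> I" for s
        unfolding P[symmetric] using that r \<epsilon> by (intro PD) (auto simp: I)
    qed (use assms(3) in \<open>simp add: smooth_on_def\<close>)
  qed
  have "smooth_on g' J"
    unfolding smooth_on_def
  proof
    fix k
    have P: "?P s0 t = t *\<^sub>R (1/2, -1/2) + (s0 / 2, s0 / 2)" for t
      by (simp add: add_divide_distrib diff_divide_distrib)
    have "C_k_on k (\<lambda>t. \<nu> (?P s0 t)) J"
      unfolding P
    proof (rule C_k_on_affine_compose[OF \<open>open J\<close> bounded_linear_scaleR_left, where S = D])
      show "t *\<^sub>R (1/2, -1/2) + (s0 / 2, s0 / 2) \<in> D" if "t \<in> J" for t
        unfolding P[symmetric] using that r \<epsilon> by (intro PD) (auto simp: J)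
    qed (use assms(3) in \<open>simp add: smooth_on_def\<close>)
    then show "C_k_on k g' J"
      unfolding g'_def[abs_def] by (intro C_k_on_bounded_linear[OF _ bounded_linear_divide]) (auto simp: J_def)
  qed
  have smooth: "smooth_on f I" "smooth_on g J"
    using smooth_on_antiderivative[OF \<open>open I\<close> df \<open>smooth_on f' I\<close>]
      smooth_on_antiderivative[OF \<open>open J\<close> dg \<open>smooth_on g' J\<close>] by blast+
  define u where "u = (\<lambda>z. (f (fst z + snd z) + g (fst z - snd z)) / 2)"
  define v where "v = (\<lambda>z. (f (fst z + snd z) - g (fst z - snd z)) / 2)"
  \<comment> \<open>In x and y this null square is a square centred at \<open>p\<close> with its
    diagonals along the axes.\<close>
  define U where "U = {z. fst z + snd z \<in> I \<and> fst z - snd z \<in> J}"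
  have hol: "lorentz_holomorphic_on (\<lambda>z. (u z, v z)) U"
    "\<And>z. z \<in> U \<Longrightarrow> (pd_x u z)\<^sup>2 - (pd_y u z)\<^sup>2 = f' (fst z + snd z) * g' (fst z - snd z)"
    using lorentz_holomorphic_null[OF \<open>open I\<close> \<open>open J\<close> smooth df dg]
    unfolding u_def v_def U_def by blast+
  have P_null: "?P (fst z + snd z) (fst z - snd z) = z" for z :: "real \<times> real"
    by (cases z) simp
  have "U \<subseteq> D"
  proof
    fix z assume "z \<in> U"
    then show "z \<in> D"
      using PD[of "fst z + snd z" "fst z - snd z"] \<epsilon>(2) unfolding P_null by (auto simp: U_def I J)
  qed
  moreover have "open U" using hol(1) by (simp add: lorentz_holomorphic_on_def)
  moreover have "p \<in> U" using \<epsilon>(1) by (simp add: U_def I J s0_def t0_def)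
  moreover have "(u z)\<^sup>2 - (v z)\<^sup>2 + 1 \<noteq> 0 \<and>
      \<nu> z = 4 * ((pd_x u z)\<^sup>2 - (pd_y u z)\<^sup>2) / ((u z)\<^sup>2 - (v z)\<^sup>2 + 1)\<^sup>2" if "z \<in> U" for z
  proof -
    have st: "\<bar>fst z + snd z - s0\<bar> < \<epsilon>" "\<bar>fst z - snd z - t0\<bar> < \<epsilon>"
      using that by (auto simp: U_def I J)
    \<comment> \<open>Since u + v and u - v are the values of \<open>f\<close> and \<open>g\<close>,
      their product is the difference of squares.\<close>
    have uv: "(u z)\<^sup>2 - (v z)\<^sup>2 + 1 = 1 + f (fst z + snd z) * g (fst z - snd z)"
      by (simp add: u_def v_def power2_eq_square field_simps)
    have E: "exp (ln (\<nu> (?P (fst z + snd z) (fst z - snd z)))) = \<nu> z"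
      "exp (ln (\<nu> (?P (fst z + snd z) t0))) = f' (fst z + snd z)"
      "exp (ln (\<nu> (?P s0 (fst z - snd z)))) / (4 * exp (ln (\<nu> (?P s0 t0)))) = g' (fst z - snd z)"
      using st \<epsilon> pos[OF subsetD[OF \<open>U \<subseteq> D\<close> that]] by (simp_all add: exp_ln_\<nu> f'_def g'_def P_null)
    show ?thesis
      using sol[OF st] fg[OF st] unfolding uv hol(2)[OF that] E by simp
  qed
  ultimately show "\<exists>U u v. open U \<and> p \<in> U \<and> U \<subseteq> D
    \<and> lorentz_holomorphic_on (\<lambda>z. (u z, v z)) U
    \<and> (\<forall>z\<in>U. (u z)\<^sup>2 - (v z)\<^sup>2 + 1 \<noteq> 0
         \<and> \<nu> z = 4 * ((pd_x u z)\<^sup>2 - (pd_y u z)\<^sup>2) / ((u z)\<^sup>2 - (v z)\<^sup>2 + 1)\<^sup>2)"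
    using hol(1) by blast
qed

end
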